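(* Let $G$ be the Heisenberg group over the integers, i.e. the group of $3\times 3$ upper triangular matrices with integer entries and $1$'s on the diagonal. There exists a thick set $T\subseteq G$ which does not contain the product $AB=\{ab:a\in A,\ b\in B\}$ of any two large sets $A,B\subseteq G$; that is, $AB\not\subseteq T$ for all large sets $A,B\subseteq G$.
   Context: A set $T\subseteq G$ is thick if for each finite set $F\subseteq G$ there is $t\in G$ with $Ft\subseteq T$. A sequence $(F_n)_{n\in\mathbb{N}}$ of (nonempty) finite subsets of $G$ is a left Følner sequence if $\lim_{n\to\infty}|gF_n\bigtriangleup F_n|/|F_n|=0$ for all $g\in G$, and a right Følner sequence if $\lim_{n\to\infty}|F_ng\bigtriangleup F_n|/|F_n|=0$ for all $g\in G$. The left (resp. right) upper Banach density of $A\subseteq G$ is the supremum of $\limsup_{n\to\infty}|A\cap F_n|/|F_n|$ over all left (resp. right) Følner sequences $(F_n)$ in $G$. A set $A\subseteq G$ is left large (resp. right large) if it has positive left (resp. right) upper Banach density, and large if it is left large or right large. *)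

theory Defs
  imports "HOL-Analysis.Analysis" "HOL-Algebra.Coset"
begin

definition heisenberg_group :: "(int ^ 3 ^ 3) monoid" where
  "heisenberg_group =
    \<lparr>carrier = {M. M $ 2 $ 1 = 0 \<and> M $ 3 $ 1 = 0 \<and> M $ 3 $ 2 = 0 \<and>
                   M $ 1 $ 1 = 1 \<and> M $ 2 $ 2 = 1 \<and> M $ 3 $ 3 = 1},
     mult = (**),
     one = mat 1\<rparr>"

lemma group_heisenberg_group: "group heisenberg_group"
proof (rule groupI)
  fix M assume "M \<in> carrier heisenberg_group"
  then have M: "M $ 2 $ 1 = 0" "M $ 3 $ 1 = 0" "M $ 3 $ 2 = 0"
    "M $ 1 $ 1 = 1" "M $ 2 $ 2 = 1" "M $ 3 $ 3 = 1"
    by (auto simp: heisenberg_group_def)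
  let ?N = "vector [vector [1, - M $ 1 $ 2, M $ 1 $ 2 * M $ 2 $ 3 - M $ 1 $ 3],
    vector [0, 1, - M $ 2 $ 3], vector [0, 0, 1]] :: int ^ 3 ^ 3"
  have "?N \<in> carrier heisenberg_group" "?N ** M = mat 1"
    using M by (auto simp: heisenberg_group_def vec_eq_iff forall_3 matrix_matrix_mult_def
      sum_3 mat_def)
  then show "\<exists>N \<in> carrier heisenberg_group. N \<otimes>\<^bsub>heisenberg_group\<^esub> M = \<one>\<^bsub>heisenberg_group\<^esub>"
    by (intro bexI[of _ ?N]) (simp_all add: heisenberg_group_def)
qed (simp_all add: heisenberg_group_def matrix_mul_assoc,
  simp_all add: matrix_matrix_mult_def sum_3 mat_def)

definition thick :: "('a, 'b) monoid_scheme \<Rightarrow> 'a set \<Rightarrow> bool" where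
  "thick G T \<longleftrightarrow> T \<subseteq> carrier G \<and>
    (\<forall>F. finite F \<and> F \<subseteq> carrier G \<longrightarrow> (\<exists>t \<in> carrier G. F #>\<^bsub>G\<^esub> t \<subseteq> T))"

definition left_Folner :: "('a, 'b) monoid_scheme \<Rightarrow> (nat \<Rightarrow> 'a set) \<Rightarrow> bool" where
  "left_Folner G F \<longleftrightarrow>
    (\<forall>n. finite (F n) \<and> F n \<noteq> {} \<and> F n \<subseteq> carrier G) \<and>
    (\<forall>g \<in> carrier G.
      (\<lambda>n. real (card (sym_diff (g <#\<^bsub>G\<^esub> F n) (F n))) / real (card (F n))) \<longlonglongrightarrow> 0)"

definition right_Folner :: "('a, 'b) monoid_scheme \<Rightarrow> (nat \<Rightarrow> 'a set) \<Rightarrow> bool" where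
  "right_Folner G F \<longleftrightarrow>
    (\<forall>n. finite (F n) \<and> F n \<noteq> {} \<and> F n \<subseteq> carrier G) \<and>
    (\<forall>g \<in> carrier G.
      (\<lambda>n. real (card (sym_diff (F n #>\<^bsub>G\<^esub> g) (F n))) / real (card (F n))) \<longlonglongrightarrow> 0)"

text \<open>
  The densities are extended reals, so that the suprema and upper limits exist unconditionally;
  if \<open>G\<close> has no left (right) Folner sequence, the supremum is \<open>- \<infinity>\<close> and no set is left (right) large.
\<close>

definition left_upper_Banach_density :: "('a, 'b) monoid_scheme \<Rightarrow> 'a set \<Rightarrow> ereal" where
  "left_upper_Banach_density G A =
    (SUP F \<in> {F. left_Folner G F}. limsup (\<lambda>n. ereal (real (card (A \<inter> F n)) / real (card (F n)))))"

definition right_upper_Banach_density :: "('a, 'b) monoid_scheme \<Rightarrow> 'a set \<Rightarrow> ereal" where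
  "right_upper_Banach_density G A =
    (SUP F \<in> {F. right_Folner G F}. limsup (\<lambda>n. ereal (real (card (A \<inter> F n)) / real (card (F n)))))"

definition left_large :: "('a, 'b) monoid_scheme \<Rightarrow> 'a set \<Rightarrow> bool" where
  "left_large G A \<longleftrightarrow> A \<subseteq> carrier G \<and> left_upper_Banach_density G A > 0"

definition right_large :: "('a, 'b) monoid_scheme \<Rightarrow> 'a set \<Rightarrow> bool" where
  "right_large G A \<longleftrightarrow> A \<subseteq> carrier G \<and> right_upper_Banach_density G A > 0"

definition large :: "('a, 'b) monoid_scheme \<Rightarrow> 'a set \<Rightarrow> bool" where
  "large G A \<longleftrightarrow> left_large G A \<or> right_large G A"

end

theory Submission
  imports Defs
begin

text \<open>
  Write \<open>(x, y, z)\<close> for the matrix with \<open>x\<close>, \<open>z\<close> in the first row and \<open>y\<close> in the second,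
  so that \<open>(x, y, z) (x', y', z') = (x + x', y + y', z + z' + x y')\<close>. The thick set is the union of
  the translates \<open>F\<^sub>n t\<^sub>n\<close> of the cubes \<open>F\<^sub>n\<close> of radius \<open>n\<close> by the sparse sequence \<open>t\<^sub>n = (0, n\<^sup>3, 0)\<close>.

  Largeness enters through the fact that the \<open>x\<close>-coordinate is unbounded on a large set: since \<open>x\<close>
  is a homomorphism, a set on which it is bounded has infinitely many pairwise disjoint left
  translates, and likewise on the right, while along a Folner sequence all translates have
  asymptotically the same density (\<open>large_imp_x_unbounded\<close>).

  Suppose that \<open>A B \<subseteq> T\<close> and choose \<open>b, b' \<in> B\<close> with different \<open>x\<close>-coordinates. For \<open>a \<in> A\<close> let
  \<open>ab \<in> F\<^sub>m t\<^sub>m\<close> and \<open>ab' \<in> F\<^sub>n t\<^sub>n\<close>. The \<open>y\<close>-coordinates of \<open>ab\<close> and \<open>ab'\<close> differ by an amount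
  that does not depend on \<open>a\<close>, so the gaps between cubes bound \<open>m\<close> and \<open>n\<close> if \<open>m \<noteq> n\<close>. If \<open>m = n\<close>,
  noncommutativity intervenes: multiplying by \<open>t\<^sub>n\<close> adds \<open>x n\<^sup>3\<close> to the \<open>z\<close>-coordinate, so the
  \<open>z\<close>-coordinates of \<open>ab\<close> and \<open>ab'\<close> are at least \<open>n\<^sup>3 - 2 n\<close> apart, whereas they should differ by \<open>O(n)\<close>. Hence
  \<open>m\<close> is bounded in terms of \<open>b\<close> and \<open>b'\<close> alone (\<open>cube_index_bound\<close>), and so is the \<open>x\<close>-coordinate
  of \<open>a\<close>, which contradicts the largeness of \<open>A\<close>.
\<close>

section \<open>Disjoint translates and Banach density\<close>

text \<open>
  The translates are given as abstract injections in order to serve for left and right translations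
  alike. By near invariance each of \<open>k\<close> disjoint translates of \<open>A\<close> fills almost the same proportion
  of \<open>F n\<close> as \<open>A\<close>, so that this proportion is asymptotically at most \<open>1 / k\<close>.
\<close>

lemma density_tendsto_0_if_disjoint_translates:
  fixes \<tau> :: "nat \<Rightarrow> 'a \<Rightarrow> 'a" and F :: "nat \<Rightarrow> 'a set"
  assumes fin: "\<And>n. finite (F n)" and ne: "\<And>n. F n \<noteq> {}" and sub: "\<And>n. F n \<subseteq> C"
    and inj: "\<And>i. inj_on (\<tau> i) C"
    and disj: "disjoint_family (\<lambda>i. \<tau> i ` A)"
    and inv: "\<And>i. (\<lambda>n. real (card (sym_diff (\<tau> i ` F n) (F n))) / real (card (F n))) \<longlonglongrightarrow> 0"
  shows "(\<lambda>n. real (card (A \<inter> F n)) / real (card (F n))) \<longlonglongrightarrow> 0"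
proof -
  define e where "e i n = real (card (sym_diff (\<tau> i ` F n) (F n))) / real (card (F n))" for i n
  define d where "d n = real (card (A \<inter> F n)) / real (card (F n))" for n
  have bound: "d n \<le> (1 + (\<Sum>i<k. e i n)) / real k" if "k > 0" for k n
  proof -
    have pos: "real (card (F n)) > 0"
      using fin ne by (simp add: card_gt_0_iff)
    have step: "card (A \<inter> F n) \<le> card (\<tau> i ` A \<inter> F n) + card (sym_diff (\<tau> i ` F n) (F n))" for i
    proof -
      have "card (A \<inter> F n) = card (\<tau> i ` (A \<inter> F n))"
        by (rule card_image[symmetric], rule inj_on_subset[OF inj]) (use sub in auto)
      also have "\<dots> \<le> card ((\<tau> i ` A \<inter> F n) \<union> sym_diff (\<tau> i ` F n) (F n))"
        by (rule card_mono) (use fin in auto)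
      also have "\<dots> \<le> card (\<tau> i ` A \<inter> F n) + card (sym_diff (\<tau> i ` F n) (F n))"
        by (rule card_Un_le)
      finally show ?thesis .
    qed
    have "(\<Sum>i<k. card (\<tau> i ` A \<inter> F n)) = card (\<Union>i<k. \<tau> i ` A \<inter> F n)"
      by (rule card_UN_disjoint[symmetric]) (use disj fin in \<open>auto simp: disjoint_family_on_def\<close>)
    also have "\<dots> \<le> card (F n)"
      by (rule card_mono) (use fin in auto)
    finally have packed: "(\<Sum>i<k. card (\<tau> i ` A \<inter> F n)) \<le> card (F n)" .
    have "k * card (A \<inter> F n) = (\<Sum>i<k. card (A \<inter> F n))"
      by simp
    also have "\<dots> \<le> (\<Sum>i<k. card (\<tau> i ` A \<inter> F n) + card (sym_diff (\<tau> i ` F n) (F n)))"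
      by (rule sum_mono) (rule step)
    also have "\<dots> \<le> card (F n) + (\<Sum>i<k. card (sym_diff (\<tau> i ` F n) (F n)))"
      using packed by (simp add: sum.distrib)
    finally have "real k * real (card (A \<inter> F n))
        \<le> real (card (F n)) + (\<Sum>i<k. real (card (sym_diff (\<tau> i ` F n) (F n))))"
      unfolding of_nat_le_iff[where 'a = real, symmetric] of_nat_mult of_nat_add of_nat_sum .
    then have "real k * real (card (A \<inter> F n)) / real (card (F n))
        \<le> (real (card (F n)) + (\<Sum>i<k. real (card (sym_diff (\<tau> i ` F n) (F n))))) / real (card (F n))"
      using pos by (simp add: divide_right_mono)
    also have "\<dots> = 1 + (\<Sum>i<k. e i n)"
      using pos by (simp add: e_def add_divide_distrib sum_divide_distrib)
    finally show ?thesis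
      using that by (simp add: d_def field_simps)
  qed
  have "d \<longlonglongrightarrow> 0"
  proof (rule order_tendstoI)
    fix a :: real assume "a < 0"
    then show "\<forall>\<^sub>F n in sequentially. a < d n"
      by (simp add: d_def less_le_trans)
  next
    fix a :: real assume "0 < a"
    then obtain k where k: "k > 0" "1 / real k < a"
      by (meson nat_approx_posE zero_less_Suc)
    have "(\<lambda>n. (1 + (\<Sum>i<k. e i n)) / real k) \<longlonglongrightarrow> (1 + (\<Sum>i<k. 0)) / real k"
      unfolding e_def by (intro tendsto_intros inv) (use k in simp)
    then have "\<forall>\<^sub>F n in sequentially. (1 + (\<Sum>i<k. e i n)) / real k < a"
      using k by (intro order_tendstoD(2)) auto
    then show "\<forall>\<^sub>F n in sequentially. d n < a"
      by eventually_elim (use bound[OF k(1)] le_less_trans in blast)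
  qed
  then show ?thesis
    unfolding d_def .
qed

context group
begin

lemma not_left_large_if_disjoint_translates:
  assumes A: "A \<subseteq> carrier G" and g: "\<And>i::nat. g i \<in> carrier G"
    and disj: "disjoint_family (\<lambda>i. g i <#\<^bsub>G\<^esub> A)"
  shows "\<not> left_large G A"
proof -
  have image: "h <#\<^bsub>G\<^esub> X = (\<lambda>x. h \<otimes>\<^bsub>G\<^esub> x) ` X" for h X
    by (auto simp: l_coset_def)
  have "limsup (\<lambda>n. ereal (real (card (A \<inter> F n)) / real (card (F n)))) = 0"
    if F: "left_Folner G F" for F
  proof -
    have "(\<lambda>n. real (card (A \<inter> F n)) / real (card (F n))) \<longlonglongrightarrow> 0"
    proof (rule density_tendsto_0_if_disjoint_translates[where C = "carrier G" and \<tau> = "\<lambda>i x. g i \<otimes>\<^bsub>G\<^esub> x"])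
      show "inj_on (\<lambda>x. g i \<otimes>\<^bsub>G\<^esub> x) (carrier G)" for i
        using g by (simp add: inj_on_def)
      show "(\<lambda>n. real (card (sym_diff ((\<lambda>x. g i \<otimes>\<^bsub>G\<^esub> x) ` F n) (F n))) / real (card (F n)))
          \<longlonglongrightarrow> 0" for i
        using F g by (simp add: left_Folner_def image)
    qed (use F disj in \<open>auto simp: left_Folner_def image\<close>)
    then have "(\<lambda>n. ereal (real (card (A \<inter> F n)) / real (card (F n)))) \<longlonglongrightarrow> ereal 0"
      by (rule tendsto_ereal)
    then show ?thesis
      by (simp add: lim_imp_Limsup zero_ereal_def)
  qed
  then have "left_upper_Banach_density G A \<le> 0"
    unfolding left_upper_Banach_density_def by (intro SUP_least) simp
  then show ?thesis
    by (simp add: left_large_def not_less)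
qed

lemma not_right_large_if_disjoint_translates:
  assumes A: "A \<subseteq> carrier G" and g: "\<And>i::nat. g i \<in> carrier G"
    and disj: "disjoint_family (\<lambda>i. A #>\<^bsub>G\<^esub> g i)"
  shows "\<not> right_large G A"
proof -
  have image: "X #>\<^bsub>G\<^esub> h = (\<lambda>x. x \<otimes>\<^bsub>G\<^esub> h) ` X" for h X
    by (auto simp: r_coset_def)
  have "limsup (\<lambda>n. ereal (real (card (A \<inter> F n)) / real (card (F n)))) = 0"
    if F: "right_Folner G F" for F
  proof -
    have "(\<lambda>n. real (card (A \<inter> F n)) / real (card (F n))) \<longlonglongrightarrow> 0"
    proof (rule density_tendsto_0_if_disjoint_translates[where C = "carrier G" and \<tau> = "\<lambda>i x. x \<otimes>\<^bsub>G\<^esub> g i"])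
      show "inj_on (\<lambda>x. x \<otimes>\<^bsub>G\<^esub> g i) (carrier G)" for i
        using g by (simp add: inj_on_def)
      show "(\<lambda>n. real (card (sym_diff ((\<lambda>x. x \<otimes>\<^bsub>G\<^esub> g i) ` F n) (F n))) / real (card (F n)))
          \<longlonglongrightarrow> 0" for i
        using F g by (simp add: right_Folner_def image)
    qed (use F disj in \<open>auto simp: right_Folner_def image\<close>)
    then have "(\<lambda>n. ereal (real (card (A \<inter> F n)) / real (card (F n)))) \<longlonglongrightarrow> ereal 0"
      by (rule tendsto_ereal)
    then show ?thesis
      by (simp add: lim_imp_Limsup zero_ereal_def)
  qed
  then have "right_upper_Banach_density G A \<le> 0"
    unfolding right_upper_Banach_density_def by (intro SUP_least) simp
  then show ?thesis
    by (simp add: right_large_def not_less)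
qed

end

section \<open>Coordinates on the Heisenberg group\<close>

definition heis :: "int \<Rightarrow> int \<Rightarrow> int \<Rightarrow> int ^ 3 ^ 3" where
  "heis x y z = vector [vector [1, x, z], vector [0, 1, y], vector [0, 0, 1]]"

lemma heis_in_carrier: "heis x y z \<in> carrier heisenberg_group"
  by (simp add: heis_def heisenberg_group_def)

lemma heis_cases:
  assumes "M \<in> carrier heisenberg_group"
  obtains x y z where "M = heis x y z"
proof
  show "M = heis (M $ 1 $ 2) (M $ 2 $ 3) (M $ 1 $ 3)"
    using assms by (auto simp: heis_def heisenberg_group_def vec_eq_iff forall_3)
qed

lemma heis_mult:
  "heis x y z \<otimes>\<^bsub>heisenberg_group\<^esub> heis x' y' z' = heis (x + x') (y + y') (z + z' + x * y')"
  by (auto simp: heis_def heisenberg_group_def vec_eq_iff forall_3 matrix_matrix_mult_def sum_3)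

lemma heis_eq_iff: "heis x y z = heis x' y' z' \<longleftrightarrow> x = x' \<and> y = y' \<and> z = z'"
  by (auto simp: heis_def vec_eq_iff forall_3)

lemma large_imp_x_unbounded:
  assumes "large heisenberg_group A"
  obtains x y z where "heis x y z \<in> A" "\<bar>x\<bar> > K"
proof -
  have A: "A \<subseteq> carrier heisenberg_group"
    using assms by (auto simp: large_def left_large_def right_large_def)
  have False if bounded: "\<forall>x y z. heis x y z \<in> A \<longrightarrow> \<bar>x\<bar> \<le> K"
  proof -
    \<comment> \<open>A step longer than the diameter of the interval \<open>[-K, K]\<close> makes the translates disjoint.\<close>
    define L where "L = 2 * \<bar>K\<bar> + 1"
    define g where "g i = heis (L * int i) 0 0" for i
    have L: "0 < L" "2 * K < L"
      by (auto simp: L_def)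
    have sep: "i = j" if eq: "L * int i + x = L * int j + x'" and x: "\<bar>x\<bar> \<le> K" "\<bar>x'\<bar> \<le> K" for i j x x'
    proof (rule ccontr)
      assume "i \<noteq> j"
      then have "1 \<le> \<bar>int i - int j\<bar>"
        by simp
      then have "L * 1 \<le> L * \<bar>int i - int j\<bar>"
        using L by (intro mult_left_mono) auto
      also have "\<dots> = \<bar>L * (int i - int j)\<bar>"
        using L by (simp add: abs_mult)
      also have "L * (int i - int j) = x' - x"
        using eq by (simp add: algebra_simps)
      finally show False
        using x L by linarith
    qed
    have coords: "\<exists>x y z. a = heis x y z \<and> \<bar>x\<bar> \<le> K" if "a \<in> A" for a
      using that A bounded heis_cases by (metis subsetD)
    interpret group heisenberg_group
      by (rule group_heisenberg_group)
    have g: "g i \<in> carrier heisenberg_group" for i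
      by (simp add: g_def heis_in_carrier)
    have "disjoint_family (\<lambda>i. g i <#\<^bsub>heisenberg_group\<^esub> A)"
      unfolding disjoint_family_on_def
    proof (intro ballI impI equals0I)
      fix i j M
      assume "i \<noteq> j" "M \<in> (g i <#\<^bsub>heisenberg_group\<^esub> A) \<inter> (g j <#\<^bsub>heisenberg_group\<^esub> A)"
      then obtain a a' where aa': "a \<in> A" "a' \<in> A"
        "g i \<otimes>\<^bsub>heisenberg_group\<^esub> a = g j \<otimes>\<^bsub>heisenberg_group\<^esub> a'"
        unfolding l_coset_def by blast
      obtain x y z x' y' z' where heis: "a = heis x y z" "a' = heis x' y' z'"
        and x: "\<bar>x\<bar> \<le> K" "\<bar>x'\<bar> \<le> K"
        using coords[OF aa'(1)] coords[OF aa'(2)] by blast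
      from aa'(3) have "L * int i + x = L * int j + x'"
        unfolding heis g_def heis_mult heis_eq_iff by simp
      then show False
        using sep x \<open>i \<noteq> j\<close> by blast
    qed
    moreover have "disjoint_family (\<lambda>i. A #>\<^bsub>heisenberg_group\<^esub> g i)"
      unfolding disjoint_family_on_def
    proof (intro ballI impI equals0I)
      fix i j M
      assume "i \<noteq> j" "M \<in> (A #>\<^bsub>heisenberg_group\<^esub> g i) \<inter> (A #>\<^bsub>heisenberg_group\<^esub> g j)"
      then obtain a a' where aa': "a \<in> A" "a' \<in> A"
        "a \<otimes>\<^bsub>heisenberg_group\<^esub> g i = a' \<otimes>\<^bsub>heisenberg_group\<^esub> g j"
        unfolding r_coset_def by blast
      obtain x y z x' y' z' where heis: "a = heis x y z" "a' = heis x' y' z'"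
        and x: "\<bar>x\<bar> \<le> K" "\<bar>x'\<bar> \<le> K"
        using coords[OF aa'(1)] coords[OF aa'(2)] by blast
      from aa'(3) have "L * int i + x = L * int j + x'"
        unfolding heis g_def heis_mult heis_eq_iff by (simp add: add.commute)
      then show False
        using sep x \<open>i \<noteq> j\<close> by blast
    qed
    ultimately show False
      using assms not_left_large_if_disjoint_translates[OF A g]
        not_right_large_if_disjoint_translates[OF A g] by (auto simp: large_def)
  qed
  then show thesis
    using that by (meson not_le)
qed

section \<open>Sparse translates of cubes\<close>

definition cube :: "nat \<Rightarrow> (int ^ 3 ^ 3) set" where
  "cube n = {heis x y z |x y z. \<bar>x\<bar> \<le> int n \<and> \<bar>y\<bar> \<le> int n \<and> \<bar>z\<bar> \<le> int n}"

definition sparse_cubes :: "(int ^ 3 ^ 3) set" where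
  "sparse_cubes = (\<Union>n. cube n #>\<^bsub>heisenberg_group\<^esub> heis 0 (int n ^ 3) 0)"

lemma heis_in_sparse_cubesE:
  assumes "heis x y z \<in> sparse_cubes"
  obtains n where "\<bar>x\<bar> \<le> int n" "\<bar>y - int n ^ 3\<bar> \<le> int n" "\<bar>z - x * int n ^ 3\<bar> \<le> int n"
  using assms by (auto simp: sparse_cubes_def cube_def r_coset_def heis_mult heis_eq_iff)

lemma finite_subset_cube:
  assumes "finite F" "F \<subseteq> carrier heisenberg_group"
  shows "\<exists>n. F \<subseteq> cube n"
  using assms
proof (induction F rule: finite_induct)
  case (insert M F)
  then obtain n where n: "F \<subseteq> cube n"
    by auto
  obtain x y z where M: "M = heis x y z"
    using insert.prems heis_cases by (metis insert_subset)
  define m where "m = nat (int n + \<bar>x\<bar> + \<bar>y\<bar> + \<bar>z\<bar>)"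
  have "cube n \<subseteq> cube m"
    by (force simp: cube_def m_def)
  moreover have "M \<in> cube m"
    unfolding cube_def M m_def by fastforce
  ultimately show ?case
    using n by blast
qed simp

lemma thick_sparse_cubes: "thick heisenberg_group sparse_cubes"
  unfolding thick_def
proof (intro conjI allI impI)
  show "sparse_cubes \<subseteq> carrier heisenberg_group"
    by (auto simp: sparse_cubes_def cube_def r_coset_def heis_mult heis_in_carrier)
  fix F :: "(int ^ 3 ^ 3) set"
  assume "finite F \<and> F \<subseteq> carrier heisenberg_group"
  then obtain n where "F \<subseteq> cube n"
    using finite_subset_cube by blast
  then have "F #>\<^bsub>heisenberg_group\<^esub> heis 0 (int n ^ 3) 0 \<subseteq> sparse_cubes"
    by (auto simp: sparse_cubes_def r_coset_def)
  then show "\<exists>t\<in>carrier heisenberg_group. F #>\<^bsub>heisenberg_group\<^esub> t \<subseteq> sparse_cubes"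
    using heis_in_carrier by blast
qed

lemma cube_gap:
  assumes "n < m" "m \<ge> 3"
  shows "int m ^ 3 - int n ^ 3 \<ge> 4 * int m"
proof -
  have "int n ^ 3 \<le> (int m - 1) ^ 3"
    using assms by (intro power_mono) auto
  moreover have "int m ^ 3 - (int m - 1) ^ 3 = 3 * (int m * int m) - 3 * int m + 1"
    by (simp add: power3_eq_cube algebra_simps)
  moreover have "3 * int m \<le> int m * int m"
    using assms by (intro mult_right_mono) auto
  ultimately show ?thesis
    using assms by linarith
qed

text \<open>
  Here \<open>(x, y, z)\<close> and \<open>(x + u, y + v, z + w + x' v)\<close> stand for \<open>ab\<close> and \<open>ab'\<close> with \<open>x'\<close> the
  \<open>x\<close>-coordinate of \<open>a\<close>: the coordinates of \<open>ab\<close> and \<open>ab'\<close> differ by constants, except for the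
  \<open>z\<close>-coordinates, whose difference is affine in \<open>x'\<close> and hence \<open>O(m)\<close>.
\<close>

lemma cube_index_bound:
  fixes x y z x' u v w :: int and m n :: nat
  assumes ab: "\<bar>x\<bar> \<le> int m" "\<bar>y - int m ^ 3\<bar> \<le> int m" "\<bar>z - x * int m ^ 3\<bar> \<le> int m"
    and ab': "\<bar>y + v - int n ^ 3\<bar> \<le> int n"
      "\<bar>z + w + x' * v - (x + u) * int n ^ 3\<bar> \<le> int n"
    and u: "u \<noteq> 0"
  shows "int m \<le> \<bar>x - x'\<bar> + \<bar>v\<bar> + \<bar>w\<bar> + 2"
proof (rule ccontr)
  define c where "c = \<bar>x - x'\<bar> + \<bar>v\<bar> + \<bar>w\<bar>"
  assume "\<not> ?thesis"
  then have m: "int m \<ge> c + 3"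
    by (simp add: c_def)
  have c: "0 \<le> c" "\<bar>v\<bar> \<le> c" "\<bar>w\<bar> \<le> c" "\<bar>x - x'\<bar> \<le> c"
    by (auto simp: c_def)
  consider "n < m" | "m < n" | "m = n"
    by linarith
  then show False
  proof cases
    case 1
    then show False
      using cube_gap[of n m] ab ab' m c by linarith
  next
    case 2
    then show False
      using cube_gap[of m n] ab ab' m c by linarith
  next
    case 3
    have "int m ^ 3 \<le> \<bar>u\<bar> * int m ^ 3"
      using u by (intro mult_left_mono[of 1 "\<bar>u\<bar>" "int m ^ 3", simplified mult.commute, simplified]) auto
    also have "\<dots> = \<bar>u * int m ^ 3\<bar>"
      by (simp add: abs_mult)
    also have "u * int m ^ 3 = (z - x * int m ^ 3) - (z + w + x' * v - (x + u) * int m ^ 3) + w + x' * v"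
      by (simp add: algebra_simps)
    also have "\<bar>\<dots>\<bar> \<le> \<bar>z - x * int m ^ 3\<bar>
        + \<bar>z + w + x' * v - (x + u) * int m ^ 3\<bar> + \<bar>w\<bar> + \<bar>x' * v\<bar>"
      by (smt (verit))
    also have "\<dots> \<le> 2 * int m + c + \<bar>x' * v\<bar>"
      using ab(3) ab'(2) c(3) unfolding 3 by linarith
    also have "\<bar>x' * v\<bar> \<le> (2 * int m) * (int m - 3)"
      unfolding abs_mult using ab c m by (intro mult_mono) auto
    finally have "int m ^ 3 \<le> 2 * int m + c + (2 * int m) * (int m - 3)"
      by simp
    also have "\<dots> \<le> 2 * (int m * int m)"
      using m c by (simp add: right_diff_distrib)
    also have "\<dots> < int m * (int m * int m)"
      using m c by (intro mult_strict_right_mono) auto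
    finally show False
      by (simp add: power3_eq_cube)
  qed
qed

theorem proposition6p3:
  shows "\<exists>T. thick heisenberg_group T \<and>
    (\<forall>A B. large heisenberg_group A \<and> large heisenberg_group B \<longrightarrow>
      \<not> (A <#>\<^bsub>heisenberg_group\<^esub> B) \<subseteq> T)"
proof (intro exI conjI allI impI notI)
  show "thick heisenberg_group sparse_cubes"
    by (rule thick_sparse_cubes)
  fix A B
  assume large: "large heisenberg_group A \<and> large heisenberg_group B"
    and sub: "A <#>\<^bsub>heisenberg_group\<^esub> B \<subseteq> sparse_cubes"
  obtain p q r where b: "heis p q r \<in> B"
    using large large_imp_x_unbounded by blast
  obtain p' q' r' where b': "heis p' q' r' \<in> B" "\<bar>p'\<bar> > \<bar>p\<bar>"
    using large large_imp_x_unbounded by blast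
  \<comment> \<open>The bound on \<open>m\<close> contains \<open>\<bar>p\<bar>\<close> once; passing from \<open>\<bar>x + p\<bar> \<le> m\<close> to \<open>\<bar>x\<bar>\<close> costs it once more.\<close>
  define K where "K = 2 * \<bar>p\<bar> + \<bar>q' - q\<bar> + \<bar>r' - r\<bar> + 2"
  obtain x y z where a: "heis x y z \<in> A" "\<bar>x\<bar> > K"
    using large large_imp_x_unbounded by blast
  have "heis (x + p) (y + q) (z + r + x * q) \<in> sparse_cubes"
    using sub a b by (auto simp: set_mult_def simp flip: heis_mult)
  then obtain m where m: "\<bar>x + p\<bar> \<le> int m" "\<bar>y + q - int m ^ 3\<bar> \<le> int m"
    "\<bar>z + r + x * q - (x + p) * int m ^ 3\<bar> \<le> int m"
    by (rule heis_in_sparse_cubesE)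
  have "heis (x + p') (y + q') (z + r' + x * q') \<in> sparse_cubes"
    using sub a b' by (auto simp: set_mult_def simp flip: heis_mult)
  then obtain n where n: "\<bar>y + q' - int n ^ 3\<bar> \<le> int n"
    "\<bar>z + r' + x * q' - (x + p') * int n ^ 3\<bar> \<le> int n"
    by (rule heis_in_sparse_cubesE)
  have "int m \<le> \<bar>x + p - x\<bar> + \<bar>q' - q\<bar> + \<bar>r' - r\<bar> + 2"
    using b' n by (intro cube_index_bound[OF m, where n = n and u = "p' - p"])
      (auto simp: algebra_simps)
  then show False
    using m(1) a(2) unfolding K_def by linarith
qed

end
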